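(* Let $r\ge 1$, let $a_1,\ldots,a_r>0$ be pairwise distinct, and let $C_{\vec n}$, $\vec n=(n_1,\ldots,n_r)\in\{0,1,2,\ldots\}^r$, be the multiple Charlier polynomials with parameters $(a_1,\ldots,a_r)$. Then for every $x\in\mathbb{C}$ and all $t_1,\ldots,t_r\in\mathbb{C}$ with $|t_1|+\cdots+|t_r|<1$, $$\sum_{n_1=0}^\infty \sum_{n_2=0}^\infty\cdots\sum_{n_r=0}^\infty C_{\vec n}(x)\,\frac{t_1^{n_1}t_2^{n_2}\cdots t_r^{n_r}}{n_1!\,n_2!\cdots n_r!}=(1+t_1+t_2+\cdots+t_r)^x\exp(-a_1t_1-a_2t_2-\cdots-a_rt_r),$$ where the power $(1+t_1+\cdots+t_r)^x$ is taken with the principal branch.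
   Context: For pairwise distinct $a_1,\ldots,a_r>0$ and a multi-index $\vec n=(n_1,\ldots,n_r)$ of non-negative integers with size $|\vec n|=n_1+\cdots+n_r$, the multiple Charlier polynomial $C_{\vec n}$ with parameters $(a_1,\ldots,a_r)$ is the (unique) monic polynomial of degree $|\vec n|$ such that $$\sum_{k=0}^\infty C_{\vec n}(k)\,k^\ell\,\frac{a_j^k}{k!}=0,\qquad \ell=0,1,\ldots,n_j-1,\quad j=1,\ldots,r$$ (with $k^0=1$ for all $k$, including $k=0$). *)

theory Defs
  imports "HOL-Analysis.Analysis" "HOL-Computational_Algebra.Polynomial"
begin

text \<open>
  The parameters and the multi-index are functions on \<open>nat\<close>, of which only the values on
  \<open>{1..r}\<close> are used.  Polynomials are taken with complex coefficients because they are
  evaluated at complex points.  Note that \<open>0 ^ 0 = 1\<close> in HOL, as the orthogonality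
  conditions require for \<open>k = l = 0\<close>.
\<close>

definition is_multiple_charlier ::
    "nat \<Rightarrow> (nat \<Rightarrow> real) \<Rightarrow> (nat \<Rightarrow> nat) \<Rightarrow> complex poly \<Rightarrow> bool" where
  "is_multiple_charlier r a n P \<longleftrightarrow>
     lead_coeff P = 1 \<and>
     degree P = (\<Sum>j=1..r. n j) \<and>
     (\<forall>j\<in>{1..r}. \<forall>l<n j.
        (\<lambda>k. poly P (of_nat k) * of_nat k ^ l * (of_real (a j) ^ k / fact k)) sums 0)"

definition multiple_charlier ::
    "nat \<Rightarrow> (nat \<Rightarrow> real) \<Rightarrow> (nat \<Rightarrow> nat) \<Rightarrow> complex poly" where
  "multiple_charlier r a n = (THE P. is_multiple_charlier r a n P)"

end

theory Submission
  imports Defs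
begin

text \<open>
  Let \<open>umbral\<close> be the linear bijection of polynomials that sends \<open>y\<^sup>i\<close> to the falling factorial
  \<open>x (x - 1) \<cdots> (x - i + 1)\<close>.  The falling factorials are the natural basis here because their
  sums against the weight \<open>a\<^sup>k / k!\<close> are \<open>a\<^sup>i exp a\<close>: summing \<open>umbral q\<close> against this weight
  just evaluates \<open>exp a * q\<close> at \<open>a\<close> (\<open>umbral_sums_poisson\<close>).  Multiplication by \<open>x\<close> on the
  umbral side corresponds to the operator \<open>q \<mapsto> y (q + q')\<close>
  (\<open>umbral_conj_mult_X\<close>).  So \<open>umbral q\<close> is orthogonal to \<open>1, k, \<dots>, k\<^bsup>n-1\<^esup>\<close> exactly if the
  iterates \<open>0, \<dots>, n - 1\<close> of this operator on \<open>q\<close> vanish at \<open>a\<close>, and for \<open>a \<noteq> 0\<close> this says that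
  \<open>q\<close> has a zero of order at least \<open>n\<close> at \<open>a\<close> (\<open>conj_mult_X_roots_iff\<close>).  As \<open>umbral\<close> preserves
  degree and leading coefficient, existence, uniqueness and an explicit form of the multiple
  Charlier polynomial come out together:  it is the umbral image of
  \<open>\<Prod>j. (y - a\<^sub>j) ^ n\<^sub>j\<close> (\<open>multiple_charlier_eq_umbral\<close>).

  The generating function is then formally the umbral image, in the variable \<open>y\<close>, of
  \<open>\<Prod>j. exp (t\<^sub>j (y - a\<^sub>j)) = exp (- \<Sum>j. a\<^sub>j t\<^sub>j) * exp (T y)\<close> with \<open>T = \<Sum>j. t\<^sub>j\<close>, and
  \<open>exp (T y)\<close> goes to \<open>\<Sum>i. (x gchoose i) T\<^sup>i = (1 + T) powr x\<close>, the binomial series.  In detail,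
  comparing coefficients of \<open>y\<^sup>i\<close> in the product of exponentials is
  \<open>egf_coeff_prod_linear_powers\<close>.  What remains is to interchange the sums over \<open>i\<close> and over the
  multi-index.  Replacing all \<open>- a\<^sub>j\<close> and \<open>t\<^sub>j\<close> by their absolute values yields a majorant that the
  same identity sums to
  a multiple of \<open>\<Sum>i. \<bar>x gchoose i\<bar> (\<Sum>j. \<bar>t\<^sub>j\<bar>)\<^sup>i\<close> (\<open>coeff_egf_summable\<close>), which converges
  because \<open>\<Sum>j. \<bar>t\<^sub>j\<bar> < 1\<close>.
\<close>

section \<open>The umbral map\<close>

text \<open>
  The falling factorials \<open>f\<^sub>i\<close> satisfy \<open>f\<^sub>i\<^sub>+\<^sub>1(x) = x * f\<^sub>i(x - 1)\<close>.  A Horner scheme with this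
  recursion defines the linear map \<open>y\<^sup>i \<mapsto> f\<^sub>i\<close> and makes its properties provable by
  induction on \<open>pCons\<close>.
\<close>

definition umbral :: "complex poly \<Rightarrow> complex poly" where
  "umbral q = fold_coeffs (\<lambda>c P. pCons c (P \<circ>\<^sub>p [:-1, 1:])) q 0"

lemma umbral_0 [simp]: "umbral 0 = 0"
  by (simp add: umbral_def)

lemma umbral_pCons [simp]: "umbral (pCons c q) = pCons c (umbral q \<circ>\<^sub>p [:-1, 1:])"
  by (cases "c = 0 \<and> q = 0") (auto simp: umbral_def)

lemma umbral_add: "umbral (p + q) = umbral p + umbral q"
  by (induction p q rule: poly_induct2) (simp_all add: pcompose_add)

lemma umbral_eq_0_iff [simp]: "umbral q = 0 \<longleftrightarrow> q = 0"
  by (induction q) (auto simp: pcompose_eq_0_iff)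

lemma degree_umbral [simp]: "degree (umbral q) = degree q"
  by (induction q) (auto simp: degree_pCons_eq_if degree_pcompose pcompose_eq_0_iff)

lemma lead_coeff_umbral: "lead_coeff (umbral q) = lead_coeff q"
proof (induction q)
  case (pCons c q)
  have "lead_coeff (umbral q \<circ>\<^sub>p [:-1, 1:]) = lead_coeff q"
    using pCons.IH by (subst lead_coeff_comp) auto
  then show ?case
    by (auto simp: lead_coeff_pCons pcompose_eq_0_iff)
qed simp

text \<open>
  Multiplication by the indeterminate, conjugated by \<open>umbral\<close>.  It is \<open>q \<mapsto> y (q + q')\<close> because
  \<open>x * f\<^sub>i = f\<^sub>i\<^sub>+\<^sub>1 + i * f\<^sub>i\<close> for the falling factorials \<open>f\<^sub>i\<close>.
\<close>

definition conj_mult_X :: "complex poly \<Rightarrow> complex poly" where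
  "conj_mult_X q = pCons 0 (q + pderiv q)"

lemma umbral_conj_mult_X: "umbral (conj_mult_X q) = pCons 0 (umbral q)"
proof (induction q)
  case (pCons c q)
  have "conj_mult_X (pCons c q) = pCons 0 ([:c:] + q + conj_mult_X q)"
    by (simp add: conj_mult_X_def pderiv_pCons)
  then have "umbral (conj_mult_X (pCons c q)) = 
        pCons 0 (([:c:] + umbral q + pCons 0 (umbral q)) \<circ>\<^sub>p [:-1, 1:])"
    by (simp add: umbral_add pCons.IH)
  also have "\<dots> = pCons 0 (umbral (pCons c q))"
    by (simp add: pcompose_add pcompose_pCons algebra_simps)
  finally show ?case .
qed (simp add: conj_mult_X_def)

lemma poly_umbral_conj_mult_X_funpow:
  "poly (umbral ((conj_mult_X ^^ l) q)) z = poly (umbral q) z * z ^ l"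
  by (induction l) (simp_all add: umbral_conj_mult_X)

text \<open>
  The operator \<open>conj_mult_X\<close> lifts each Horner step \<open>c + x P\<close> through \<open>umbral\<close>, so a preimage can
  be built up coefficient by coefficient.
\<close>

lemma umbral_surj: "\<exists>q. P = umbral q"
proof (induction P)
  case (pCons c P)
  then obtain q where "P = umbral q" by blast
  then have "pCons c P = umbral ([:c:] + conj_mult_X q)"
    by (simp add: umbral_add umbral_conj_mult_X)
  then show ?case by blast
qed (auto intro: exI[of _ 0])

text \<open>
  In the sum of a polynomial \<open>x * P(x - 1)\<close> against \<open>a\<^sup>k / k!\<close>, the factor \<open>k\<close> cancels against
  \<open>k!\<close>; shifting the index then leaves \<open>a\<close> times the sum of \<open>P\<close>.  Hence each \<open>pCons\<close> on the
  left is matched by a Horner step for \<open>poly q a\<close> on the right.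
\<close>

lemma umbral_sums_poisson:
  fixes a :: complex
  shows "(\<lambda>k. poly (umbral q) (of_nat k) * (a ^ k / fact k)) sums (exp a * poly q a)"
proof (induction q)
  case (pCons c q)
  have "(\<lambda>k. a ^ k /\<^sub>R fact k) sums exp a"
    by (rule exp_converges)
  then have "(\<lambda>k. c * (a ^ k / fact k)) sums (c * exp a)"
    by (intro sums_mult) (simp add: scaleR_conv_of_real field_simps)
  moreover have "(\<lambda>k. of_nat k * poly (umbral q) (of_nat k - 1) * (a ^ k / fact k))
      sums (a * (exp a * poly q a))"
  proof (rule sums_Suc_imp)
    have "of_nat (Suc k) * poly (umbral q) (of_nat (Suc k) - 1) * (a ^ Suc k / fact (Suc k))
        = a * (poly (umbral q) (of_nat k) * (a ^ k / fact k))" for k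
    proof -
      have "of_nat (Suc k) - 1 = (of_nat k :: complex)"
        by simp
      moreover have "m * v * (a * p / (m * f)) = a * (v * (p / f))" if "m \<noteq> 0" for m v p f :: complex
        using that by simp
      ultimately show ?thesis
        by (simp only: fact_Suc power_Suc of_nat_neq_0 not_False_eq_True)
    qed
    then show "(\<lambda>k. of_nat (Suc k) * poly (umbral q) (of_nat (Suc k) - 1)
        * (a ^ Suc k / fact (Suc k))) sums (a * (exp a * poly q a))"
      using sums_mult[OF pCons.IH, of a] by simp
  qed simp
  ultimately have "(\<lambda>k. c * (a ^ k / fact k)
       + of_nat k * poly (umbral q) (of_nat k - 1) * (a ^ k / fact k))
      sums (c * exp a + a * (exp a * poly q a))"
    by (rule sums_add)
  then show ?case
    by (simp add: poly_pcompose algebra_simps)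
qed simp

text \<open>
  Up to the factor \<open>fact i\<close>, the falling factorial is a generalised binomial coefficient; this is
  how the binomial series enters.  The bound \<open>N\<close> is arbitrary so that the induction can lower it
  by one.
\<close>

lemma poly_umbral:
  assumes "degree q \<le> N"
  shows "poly (umbral q) x = (\<Sum>i\<le>N. coeff q i * (fact i * (x gchoose i)))"
  using assms
proof (induction q arbitrary: N x)
  case (pCons c q)
  show ?case
  proof (cases N)
    case 0
    then have "q = 0" using pCons.prems by (auto simp: degree_pCons_eq_if split: if_splits)
    then show ?thesis using 0 by simp
  next
    case (Suc M)
    have "degree q \<le> M"
      using pCons.prems Suc by (auto simp: degree_pCons_eq_if split: if_splits)
    then have "poly (umbral q) (x - 1) = (\<Sum>i\<le>M. coeff q i * (fact i * ((x - 1) gchoose i)))"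
      by (rule pCons.IH)
    moreover have "fact (Suc i) * (x gchoose Suc i) = x * (fact i * ((x - 1) gchoose i))" for i
      using gbinomial_absorption[of i x] by (simp add: algebra_simps del: of_nat_Suc)
    ultimately show ?thesis
      unfolding Suc sum.atMost_Suc_shift
      by (simp add: poly_pcompose sum_distrib_left mult_ac del: fact_Suc)
  qed
qed simp

section \<open>Multiple Charlier polynomials as umbral images\<close>

lemma linear_power_dvd_iff:
  fixes s :: "complex poly"
  assumes "poly s a \<noteq> 0"
  shows "[:-a, 1:] ^ n dvd [:-a, 1:] ^ m * s \<longleftrightarrow> n \<le> m"
proof -
  have "[:-a, 1:] ^ m * s \<noteq> 0"
    using assms by auto
  then show ?thesis
    using assms by (simp add: order_divides order_mult order_power_n_n order_0I)
qed

text \<open>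
  Differentiation lowers the order of a zero by exactly one, so adding \<open>q\<close> itself cannot
  restore it, and the factor \<open>y\<close> does not vanish at \<open>a \<noteq> 0\<close>: \<open>conj_mult_X\<close> lowers the order
  of a zero at \<open>a\<close> by exactly one.
\<close>

lemma linear_power_dvd_conj_mult_X_iff:
  assumes "a \<noteq> 0" and "poly q a = 0"
  shows "[:-a, 1:] ^ n dvd conj_mult_X q \<longleftrightarrow> [:-a, 1:] ^ Suc n dvd q"
proof (cases "q = 0")
  case False
  obtain s where s: "q = [:-a, 1:] ^ order a q * s" "\<not> [:-a, 1:] dvd s"
    using order_decomp[OF False] by blast
  obtain m where m: "order a q = Suc m"
    using False assms(2) by (metis not0_implies_Suc order_root)
  have q: "q = [:-a, 1:] ^ Suc m * s" and sa: "poly s a \<noteq> 0"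
    using s by (simp_all only: m poly_eq_0_iff_dvd not_False_eq_True)
  \<comment> \<open>\<open>u\<close> is the cofactor left in \<open>y (q + q')\<close> after \<open>L ^ m\<close> is split off; at \<open>a\<close> only its
     middle summand survives, which gives \<open>u(a) = a (m + 1) s(a)\<close>.\<close>
  define L where "L = [:-a, 1:]"
  define u where "u = [:0, 1:] * (L * s + smult (of_nat (Suc m)) s + L * pderiv s)"
  have qL: "q = L ^ Suc m * s" and "pderiv L = 1"
    using q by (simp_all add: L_def pderiv_pCons)
  then have "pderiv q = L ^ m * (smult (of_nat (Suc m)) s + L * pderiv s)"
    unfolding qL pderiv_mult pderiv_power_Suc by (simp add: distrib_left mult_ac del: of_nat_Suc)
  moreover have "conj_mult_X q = [:0, 1:] * (q + pderiv q)"
    by (simp add: conj_mult_X_def)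
  ultimately have "conj_mult_X q = L ^ m * u"
    unfolding u_def qL by (simp only: power_Suc distrib_left mult_ac add_ac)
  then have "conj_mult_X q = [:-a, 1:] ^ m * u"
    by (simp add: L_def)
  moreover have "poly u a \<noteq> 0"
    using assms(1) sa by (simp add: u_def L_def del: of_nat_Suc)
  ultimately show ?thesis
    using linear_power_dvd_iff[of u a n m] linear_power_dvd_iff[OF sa, of "Suc n" "Suc m"] q
    by simp
qed (simp add: conj_mult_X_def)

text \<open>
  The condition for \<open>l = 0\<close> provides the zero whose order \<open>conj_mult_X\<close> lowers by one, and the
  remaining conditions are the same statement, one step shorter, about \<open>conj_mult_X q\<close>.
\<close>

lemma conj_mult_X_roots_iff:
  assumes "a \<noteq> 0"
  shows "(\<forall>l<n. poly ((conj_mult_X ^^ l) q) a = 0) \<longleftrightarrow> [:-a, 1:] ^ n dvd q"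
proof (induction n arbitrary: q)
  case (Suc n)
  have "(\<forall>l<Suc n. poly ((conj_mult_X ^^ l) q) a = 0) \<longleftrightarrow>
        poly q a = 0 \<and> [:-a, 1:] ^ n dvd conj_mult_X q"
    by (simp add: All_less_Suc2 funpow_Suc_right Suc.IH[symmetric] del: funpow.simps(2))
  also have "\<dots> \<longleftrightarrow> [:-a, 1:] ^ Suc n dvd q"
    using linear_power_dvd_conj_mult_X_iff[OF assms, of q n]
    by (metis dvd_mult_left poly_eq_0_iff_dvd power_Suc)
  finally show ?case .
qed simp

lemma prod_linear_powers_dvd:
  fixes q :: "complex poly"
  assumes "finite J" and "inj_on \<alpha> J" and "\<And>j. j \<in> J \<Longrightarrow> [:-\<alpha> j, 1:] ^ n j dvd q"
  shows "(\<Prod>j\<in>J. [:-\<alpha> j, 1:] ^ n j) dvd q"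
  using assms
proof (induction J)
  case (insert j J)
  let ?R = "\<Prod>i\<in>J. [:-\<alpha> i, 1:] ^ n i"
  obtain s where s: "q = ?R * s"
    using insert.IH insert.prems by (auto elim!: dvdE)
  have "poly ?R (\<alpha> j) \<noteq> 0"
    using insert.hyps insert.prems(1) by (auto simp: poly_prod)
  moreover have "[:-\<alpha> j, 1:] ^ n j dvd ?R * s"
    using insert.prems(2)[of j] s by simp
  moreover have "order (\<alpha> j) (?R * s) = order (\<alpha> j) ?R + order (\<alpha> j) s" if "s \<noteq> 0"
    using that \<open>poly ?R (\<alpha> j) \<noteq> 0\<close> by (intro order_mult) auto
  ultimately have "[:-\<alpha> j, 1:] ^ n j dvd s"
    unfolding order_divides using order_0I[of ?R "\<alpha> j"] by (metis add_0 mult_eq_0_iff poly_0)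
  then show ?case
    using insert.hyps s by (simp add: mult.commute mult_dvd_mono)
qed simp

lemma monic_dvd_same_degree_imp_eq:
  fixes p q :: "complex poly"
  assumes "p dvd q" and "degree p = degree q" and "lead_coeff p = 1" and "lead_coeff q = 1"
  shows "p = q"
proof -
  obtain s where s: "q = p * s" using assms(1) by (elim dvdE)
  have "p \<noteq> 0" "q \<noteq> 0" using assms(3,4) by auto
  then have "s \<noteq> 0" using s by auto
  have "degree s = 0"
    using assms(2) \<open>p \<noteq> 0\<close> \<open>s \<noteq> 0\<close> unfolding s by (simp add: degree_mult_eq)
  then obtain c where "s = [:c:]" by (elim degree_eq_zeroE)
  then have "c = 1" using s assms(3,4) lead_coeff_smult[of c p] by simp
  then show ?thesis using s \<open>s = [:c:]\<close> by simp
qed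

text \<open>
  Transported through \<open>umbral\<close>, the orthogonality conditions say that each \<open>(y - a\<^sub>j) ^ n\<^sub>j\<close> divides
  \<open>q\<close>.  As the \<open>a\<^sub>j\<close> are distinct, the product of these powers divides \<open>q\<close>; it has the prescribed
  degree and is monic, so it is \<open>q\<close>.
\<close>

lemma is_multiple_charlier_umbral_iff:
  assumes "\<And>j. j \<in> {1..r} \<Longrightarrow> a j > 0" and "inj_on a {1..r}"
  shows "is_multiple_charlier r a n (umbral q) \<longleftrightarrow>
           q = (\<Prod>j=1..r. [:- complex_of_real (a j), 1:] ^ n j)"
proof -
  define \<alpha> where "\<alpha> = (\<lambda>j. complex_of_real (a j))"
  define R where "R = (\<Prod>j=1..r. [:- \<alpha> j, 1:] ^ n j)"
  have \<alpha>_eq: "complex_of_real (a j) = \<alpha> j" for j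
    by (simp add: \<alpha>_def)
  have degree_R: "degree R = (\<Sum>j=1..r. n j)"
    unfolding R_def by (subst degree_prod_sum_eq) (auto simp: degree_linear_power)
  have lead_R: "lead_coeff R = 1"
    unfolding R_def by (simp add: lead_coeff_prod lead_coeff_power)
  have \<alpha>_nonzero: "\<alpha> j \<noteq> 0" if "j \<in> {1..r}" for j
    using assms(1)[OF that] by (simp add: \<alpha>_def)
  have \<alpha>_inj: "inj_on \<alpha> {1..r}"
    using assms(2) unfolding inj_on_def \<alpha>_def of_real_eq_iff .
  have orth: "(\<lambda>k. poly (umbral q) (of_nat k) * of_nat k ^ l * (\<alpha> j ^ k / fact k)) sums 0
      \<longleftrightarrow> poly ((conj_mult_X ^^ l) q) (\<alpha> j) = 0" for j l
    using umbral_sums_poisson[of "(conj_mult_X ^^ l) q" "\<alpha> j"]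
    by (auto simp: poly_umbral_conj_mult_X_funpow dest: sums_unique2)
  have "is_multiple_charlier r a n (umbral q) \<longleftrightarrow>
      lead_coeff q = 1 \<and> degree q = degree R \<and> (\<forall>j\<in>{1..r}. [:- \<alpha> j, 1:] ^ n j dvd q)"
    unfolding is_multiple_charlier_def lead_coeff_umbral
    unfolding degree_umbral degree_R \<alpha>_eq orth
    using conj_mult_X_roots_iff[OF \<alpha>_nonzero] by simp
  also have "\<dots> \<longleftrightarrow> q = R"
  proof
    assume *: "lead_coeff q = 1 \<and> degree q = degree R \<and> (\<forall>j\<in>{1..r}. [:- \<alpha> j, 1:] ^ n j dvd q)"
    then have "R dvd q"
      unfolding R_def using \<alpha>_inj by (intro prod_linear_powers_dvd) auto
    then show "q = R"
      using * lead_R by (intro monic_dvd_same_degree_imp_eq[symmetric]) auto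
  next
    assume "q = R"
    then show "lead_coeff q = 1 \<and> degree q = degree R \<and> (\<forall>j\<in>{1..r}. [:- \<alpha> j, 1:] ^ n j dvd q)"
      using lead_R by (auto simp: R_def intro!: dvd_prodI)
  qed
  finally show ?thesis by (simp add: R_def \<alpha>_def)
qed

lemma multiple_charlier_eq_umbral:
  assumes "\<And>j. j \<in> {1..r} \<Longrightarrow> a j > 0" and "inj_on a {1..r}"
  shows "multiple_charlier r a n = umbral (\<Prod>j=1..r. [:- complex_of_real (a j), 1:] ^ n j)"
  unfolding multiple_charlier_def
proof (rule the_equality)
  fix P assume P: "is_multiple_charlier r a n P"
  obtain q where "P = umbral q" using umbral_surj by blast
  then show "P = umbral (\<Prod>j=1..r. [:- complex_of_real (a j), 1:] ^ n j)"
    using P is_multiple_charlier_umbral_iff[OF assms, of n q] by simp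
qed (use is_multiple_charlier_umbral_iff[OF assms] in blast)

section \<open>Exponential generating functions of coefficients\<close>

text \<open>
  Summable families of complex numbers are absolutely summable, so the product family is too, and
  it may be summed one index at a time.
\<close>

lemma has_sum_times_complex:
  fixes f :: "'a \<Rightarrow> complex" and g :: "'b \<Rightarrow> complex"
  assumes f: "(f has_sum u) A" and g: "(g has_sum v) B"
  shows "((\<lambda>(x, y). f x * g y) has_sum (u * v)) (A \<times> B)"
proof (rule has_sum_SigmaI)
  show "((\<lambda>y. case (x, y) of (x, y) \<Rightarrow> f x * g y) has_sum (f x * v)) B" for x
    using has_sum_cmult_right[OF g] by simp
  show "((\<lambda>x. f x * v) has_sum (u * v)) A"
    using has_sum_cmult_left[OF f] .
  have "(\<lambda>x. norm (f x)) summable_on A" "(\<lambda>y. norm (g y)) summable_on B"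
    using f g by (auto simp: summable_on_iff_abs_summable_on_complex[symmetric] summable_on_def)
  then have "(\<lambda>(x, y). norm (f x) * norm (g y)) summable_on A \<times> B"
    by (intro summable_on_SigmaI[where g = "\<lambda>x. norm (f x) * infsum (\<lambda>y. norm (g y)) B"])
       (auto intro!: has_sum_cmult_right summable_on_cmult_left)
  then show "(\<lambda>(x, y). f x * g y) summable_on A \<times> B"
    by (subst summable_on_iff_abs_summable_on_complex) (simp add: case_prod_unfold norm_mult)
qed

lemma has_sum_finite_sum:
  fixes f :: "'i \<Rightarrow> 'a \<Rightarrow> 'b :: topological_comm_monoid_add"
  assumes "\<And>i. i \<in> I \<Longrightarrow> (f i has_sum s i) A"
  shows "((\<lambda>x. \<Sum>i\<in>I. f i x) has_sum (\<Sum>i\<in>I. s i)) A"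
  using assms by (induction I rule: infinite_finite_induct) (auto intro!: has_sum_add)

text \<open>
  The coefficient of \<open>y\<^sup>i\<close> in \<open>\<Sum>n. (y + b)\<^sup>n t\<^sup>n / n! = exp (b t) exp (t y)\<close>.
\<close>

lemma egf_coeff_linear_power:
  fixes b t :: complex
  shows "((\<lambda>n. coeff ([:b, 1:] ^ n) i * (t ^ n / fact n)) has_sum (exp (b * t) * (t ^ i / fact i))) UNIV"
proof -
  have "(\<lambda>m. (b * t) ^ m /\<^sub>R fact m) sums exp (b * t)"
    by (rule exp_converges)
  then have "((\<lambda>m. (b * t) ^ m /\<^sub>R fact m) has_sum exp (b * t)) UNIV"
    using summable_norm_exp by (rule norm_summable_imp_has_sum[rotated])
  then have "((\<lambda>m. (b * t) ^ m /\<^sub>R fact m * (t ^ i / fact i)) has_sum (exp (b * t) * (t ^ i / fact i))) UNIV"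
    by (rule has_sum_cmult_left)
  \<comment> \<open>Only exponents \<open>n = i + m\<close> contribute, and they reproduce the exponential series.\<close>
  moreover have coeff: "coeff ([:b, 1:] ^ (i + m)) i = of_nat (i + m choose i) * b ^ m" for m
    by (simp add: coeff_linear_poly_power del: power_Suc)
  moreover have "(b * t) ^ m /\<^sub>R fact m * (t ^ i / fact i)
      = coeff ([:b, 1:] ^ (i + m)) i * (t ^ (i + m) / fact (i + m))" for m
    unfolding coeff by (simp add: binomial_fact power_add power_mult_distrib scaleR_conv_of_real field_simps)
  ultimately have "((\<lambda>n. coeff ([:b, 1:] ^ n) i * (t ^ n / fact n)) has_sum (exp (b * t) * (t ^ i / fact i)))
      (range (\<lambda>m. i + m))"
    by (subst has_sum_reindex) (auto simp: o_def)
  then show ?thesis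
  proof (subst has_sum_cong_neutral[where T = "range (\<lambda>m. i + m)"])
    fix n assume "n \<in> UNIV - range (\<lambda>m. i + m)"
    then have "n < i" by (metis DiffD2 le_iff_add not_le rangeI)
    then show "coeff ([:b, 1:] ^ n) i * (t ^ n / fact n) = 0"
      by (simp add: coeff_eq_0 degree_linear_power)
  qed auto
qed

text \<open>
  The coefficient of \<open>y\<^sup>i\<close> in \<open>\<Prod>j. exp (t\<^sub>j (y + b\<^sub>j))\<close>.  For a new index \<open>x\<close>, the coefficient of
  the product is a finite convolution, each of whose terms factors over \<open>n\<^sub>x\<close> and the other
  exponents; the binomial theorem recombines the powers \<open>t\<^sub>x\<^sup>k\<close> and \<open>(\<Sum>j\<in>J. t\<^sub>j) ^ (i - k)\<close>.
\<close>

lemma egf_coeff_prod_linear_powers: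
  fixes b t :: "'j \<Rightarrow> complex"
  assumes "finite J"
  shows "((\<lambda>n. coeff (\<Prod>j\<in>J. [:b j, 1:] ^ n j) i * (\<Prod>j\<in>J. t j ^ n j / fact (n j)))
           has_sum (exp (\<Sum>j\<in>J. b j * t j) * ((\<Sum>j\<in>J. t j) ^ i / fact i))) (J \<rightarrow>\<^sub>E UNIV)"
  using assms
proof (induction J arbitrary: i)
  case empty
  then show ?case by (cases i) (auto intro!: has_sum_finiteI)
next
  case (insert x J)
  let ?P = "\<lambda>n. \<Prod>j\<in>J. [:b j, 1:] ^ n j" and ?w = "\<lambda>n. \<Prod>j\<in>J. t j ^ n j / fact (n j)"
  let ?B = "\<Sum>j\<in>J. b j * t j" and ?T = "\<Sum>j\<in>J. t j"
  have "((\<lambda>(y, g). \<Sum>k\<le>i. (coeff ([:b x, 1:] ^ y) k * (t x ^ y / fact y)) * (coeff (?P g) (i - k) * ?w g))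
      has_sum (\<Sum>k\<le>i. (exp (b x * t x) * (t x ^ k / fact k)) * (exp ?B * (?T ^ (i - k) / fact (i - k)))))
      (UNIV \<times> (J \<rightarrow>\<^sub>E UNIV))"
    using has_sum_finite_sum[OF has_sum_times_complex[OF egf_coeff_linear_power insert.IH]]
    by (simp add: case_prod_unfold)
  moreover have "(\<Sum>k\<le>i. (exp (b x * t x) * (t x ^ k / fact k)) * (exp ?B * (?T ^ (i - k) / fact (i - k))))
      = exp (b x * t x + ?B) * ((t x + ?T) ^ i / fact i)"
    unfolding binomial_ring sum_divide_distrib sum_distrib_left
    by (intro sum.cong) (auto simp: binomial_fact exp_add)
  moreover have "(\<Sum>k\<le>i. (coeff ([:b x, 1:] ^ y) k * (t x ^ y / fact y)) * (coeff (?P g) (i - k) * ?w g))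
      = coeff ([:b x, 1:] ^ y * ?P g) i * (t x ^ y / fact y * ?w g)" for y g
    unfolding coeff_mult sum_distrib_right by (intro sum.cong) (auto simp: mult_ac)
  ultimately have *: "((\<lambda>(y, g). coeff ([:b x, 1:] ^ y * ?P g) i * (t x ^ y / fact y * ?w g))
      has_sum (exp (b x * t x + ?B) * ((t x + ?T) ^ i / fact i))) (UNIV \<times> (J \<rightarrow>\<^sub>E UNIV))"
    by simp
  have P: "?P (g(x := y)) = ?P g" and w: "?w (g(x := y)) = ?w g" for g y
    using insert.hyps by (auto intro!: prod.cong)
  show ?case
    unfolding PiE_insert_eq
    by (subst has_sum_reindex[OF inj_combinator[OF insert.hyps(2)]])
       (use * insert.hyps in \<open>simp add: o_def case_prod_unfold P w fun_upd_same del: fun_upd_apply\<close>)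
qed

text \<open>
  The majorant \<open>P\<close> stays a complex polynomial, although its coefficients are required to be real,
  so that the identity \<open>egf_coeff_prod_linear_powers\<close> applies to it directly.
\<close>

definition coeffs_dominated :: "complex poly \<Rightarrow> complex poly \<Rightarrow> bool" where
  "coeffs_dominated p P \<longleftrightarrow> (\<forall>i. \<exists>c. coeff P i = of_real c \<and> norm (coeff p i) \<le> c)"

lemma coeffs_dominated_mult:
  assumes "coeffs_dominated p P" and "coeffs_dominated q Q"
  shows "coeffs_dominated (p * q) (P * Q)"
proof -
  obtain c where c: "\<And>i. coeff P i = of_real (c i) \<and> norm (coeff p i) \<le> c i"
    using assms(1) unfolding coeffs_dominated_def by metis
  obtain d where d: "\<And>i. coeff Q i = of_real (d i) \<and> norm (coeff q i) \<le> d i"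
    using assms(2) unfolding coeffs_dominated_def by metis
  show ?thesis
    unfolding coeffs_dominated_def
  proof (intro allI exI conjI)
    fix i
    show "coeff (P * Q) i = of_real (\<Sum>k\<le>i. c k * d (i - k))"
      by (simp add: coeff_mult c d)
    have "0 \<le> c k" for k using c[of k] norm_ge_zero order_trans by blast
    then show "norm (coeff (p * q) i) \<le> (\<Sum>k\<le>i. c k * d (i - k))"
      unfolding coeff_mult
      by (intro order_trans[OF norm_sum] sum_mono) (auto simp: norm_mult c d intro!: mult_mono)
  qed
qed

lemma coeffs_dominated_1: "coeffs_dominated 1 1"
  unfolding coeffs_dominated_def
proof
  show "\<exists>c. coeff 1 i = complex_of_real c \<and> norm (coeff (1 :: complex poly) i) \<le> c" for i
    by (rule exI[of _ "if i = 0 then 1 else 0"]) simp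
qed

lemma coeffs_dominated_linear: "coeffs_dominated [:b, 1:] [:of_real (norm b), 1:]"
  unfolding coeffs_dominated_def
proof
  show "\<exists>c. coeff [:of_real (norm b), 1:] i = complex_of_real c \<and> norm (coeff [:b, 1:] i) \<le> c" for i
    by (rule exI[of _ "if i = 0 then norm b else if i = 1 then 1 else 0"])
       (auto simp: coeff_pCons split: nat.splits)
qed

lemma coeffs_dominated_prod_linear_powers:
  "coeffs_dominated (\<Prod>j\<in>J. [:b j, 1:] ^ n j) (\<Prod>j\<in>J. [:of_real (norm (b j)), 1:] ^ n j)"
proof -
  have power: "coeffs_dominated ([:c, 1:] ^ m) ([:of_real (norm c), 1:] ^ m)" for c m
    by (induction m) (auto simp del: mult_pCons_left intro: coeffs_dominated_1 coeffs_dominated_mult coeffs_dominated_linear)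
  show ?thesis
    by (induction J rule: infinite_finite_induct)
       (auto intro: coeffs_dominated_1 coeffs_dominated_mult power)
qed

text \<open>
  Absolute convergence of the double series, obtained by comparison with the series for
  \<open>\<bar>b\<^sub>j\<bar>\<close> and \<open>\<bar>t\<^sub>j\<bar>\<close>.  All terms of the latter are nonnegative, so it may be summed
  iteratively, and its inner sums are known in closed form.
\<close>

lemma coeff_egf_summable:
  fixes b t :: "'j \<Rightarrow> complex" and c :: "nat \<Rightarrow> complex"
  assumes "finite J" and "summable (\<lambda>i. norm (c i) * (\<Sum>j\<in>J. norm (t j)) ^ i / fact i)"
  shows "(\<lambda>(i, n). c i * (coeff (\<Prod>j\<in>J. [:b j, 1:] ^ n j) i * (\<Prod>j\<in>J. t j ^ n j / fact (n j))))
           summable_on (UNIV \<times> (J \<rightarrow>\<^sub>E UNIV))"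
proof -
  let ?p = "\<lambda>n. \<Prod>j\<in>J. [:b j, 1:] ^ n j" and ?w = "\<lambda>n. \<Prod>j\<in>J. t j ^ n j / fact (n j)"
  define P where "P = (\<lambda>n. \<Prod>j\<in>J. [:complex_of_real (norm (b j)), 1:] ^ n j)"
  define M where "M = (\<lambda>(i, n). norm (c i) * (Re (coeff (P n) i) * norm (?w n)))"
  have norm_w: "norm (?w n) = (\<Prod>j\<in>J. norm (t j) ^ n j / fact (n j))" for n
    by (simp add: prod_norm[symmetric] norm_divide norm_power)
  have dominated: "norm (coeff (?p n) i) \<le> Re (coeff (P n) i)" for n i
    using coeffs_dominated_prod_linear_powers[of b n J] unfolding coeffs_dominated_def P_def
    by (metis Re_complex_of_real)
  have Re_of_real_right: "Re (z * of_real v) = Re z * v" for z v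
    by simp
  define E where "E = exp (\<Sum>j\<in>J. norm (b j) * norm (t j))"
  have "((\<lambda>n. Re (coeff (P n) i) * norm (?w n)) has_sum (E * ((\<Sum>j\<in>J. norm (t j)) ^ i / fact i)))
      (J \<rightarrow>\<^sub>E UNIV)" for i
  proof -
    have "((\<lambda>n. coeff (P n) i * of_real (norm (?w n))) has_sum
        of_real (E * ((\<Sum>j\<in>J. norm (t j)) ^ i / fact i))) (J \<rightarrow>\<^sub>E UNIV)"
      using egf_coeff_prod_linear_powers[OF assms(1), of "\<lambda>j. of_real (norm (b j))" i "\<lambda>j. of_real (norm (t j))"]
      by (simp add: P_def E_def norm_w exp_of_real[symmetric])
    from has_sum_Re[OF this] show ?thesis
      by (simp only: Re_of_real_right Re_complex_of_real)
  qed
  then have "((\<lambda>n. M (i, n)) has_sum (norm (c i) * (E * ((\<Sum>j\<in>J. norm (t j)) ^ i / fact i)))) (J \<rightarrow>\<^sub>E UNIV)" for i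
    unfolding M_def prod.case by (rule has_sum_cmult_right)
  moreover have "(\<lambda>i. norm (c i) * (E * ((\<Sum>j\<in>J. norm (t j)) ^ i / fact i))) summable_on UNIV"
  proof (rule norm_summable_imp_summable_on)
    have "norm (norm (c i) * (E * ((\<Sum>j\<in>J. norm (t j)) ^ i / fact i)))
        = E * (norm (c i) * (\<Sum>j\<in>J. norm (t j)) ^ i / fact i)" for i
      by (simp add: E_def sum_nonneg abs_mult)
    then show "summable (\<lambda>i. norm (norm (c i) * (E * ((\<Sum>j\<in>J. norm (t j)) ^ i / fact i))))"
      using summable_mult[OF assms(2), of E] by simp
  qed
  moreover have "0 \<le> M (i, n)" for i n
    using order_trans[OF norm_ge_zero dominated] by (simp add: M_def)
  ultimately have "M summable_on (UNIV \<times> (J \<rightarrow>\<^sub>E UNIV))"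
    by (intro summable_on_SigmaI) auto
  then show ?thesis
    unfolding summable_on_iff_abs_summable_on_complex
  proof (rule summable_on_comparison_test)
    fix z :: "nat \<times> ('j \<Rightarrow> nat)"
    obtain i n where z: "z = (i, n)" by (cases z)
    show "norm (case z of (i, n) \<Rightarrow> c i * (coeff (?p n) i * ?w n)) \<le> M z"
      unfolding z M_def by (simp only: prod.case norm_mult) (intro mult_left_mono mult_right_mono dominated, auto)
  qed auto
qed

section \<open>The generating function\<close>

theorem theorem2p1:
  fixes r :: nat and a :: "nat \<Rightarrow> real" and x :: complex and t :: "nat \<Rightarrow> complex"
  assumes "r \<ge> 1"
    and "\<And>j. j \<in> {1..r} \<Longrightarrow> a j > 0"
    and "inj_on a {1..r}"
    and "(\<Sum>j=1..r. norm (t j)) < 1"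
  shows "((\<lambda>n. poly (multiple_charlier r a n) x * ((\<Prod>j=1..r. t j ^ n j) / (\<Prod>j=1..r. fact (n j))))
           has_sum ((1 + (\<Sum>j=1..r. t j)) powr x * exp (- (\<Sum>j=1..r. of_real (a j) * t j))))
         ({1..r} \<rightarrow>\<^sub>E (UNIV :: nat set))"
proof -
  let ?N = "{1..r} \<rightarrow>\<^sub>E (UNIV :: nat set)"
  define s where "s = (\<Sum>j=1..r. norm (t j))"
  define T where "T = (\<Sum>j=1..r. t j)"
  define E where "E = exp (- (\<Sum>j=1..r. of_real (a j) * t j))"
  define w where "w = (\<lambda>n. \<Prod>j=1..r. t j ^ n j / fact (n j))"
  define q where "q = (\<lambda>n. \<Prod>j=1..r. [:- complex_of_real (a j), 1:] ^ n j)"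
  define c where "c = (\<lambda>i. fact i * (x gchoose i))"
  define f where "f = (\<lambda>(i, n). c i * (coeff (q n) i * w n))"
  have abs_binomial: "summable (\<lambda>i. norm ((x gchoose i) * z ^ i))" if "norm z < 1" for z
    using that by (intro abs_summable_in_conv_radius) (auto simp: conv_radius_gchoose)
  have s: "0 \<le> s" "s < 1"
    using assms(4) by (simp_all add: s_def sum_nonneg)
  have norm_T: "norm T < 1"
    using norm_sum[of t "{1..r}"] assms(4) by (simp add: T_def)
  have summable_f: "f summable_on (UNIV \<times> ?N)"
  proof -
    have "norm (c i) * s ^ i / fact i = norm ((x gchoose i) * of_real s ^ i)" for i
      using s by (simp add: c_def norm_mult norm_power)
    then have "summable (\<lambda>i. norm (c i) * s ^ i / fact i)"
      using abs_binomial[of "of_real s"] s by simp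
    then show ?thesis
      using coeff_egf_summable[of "{1..r}" c t "\<lambda>j. - of_real (a j)"]
      by (simp add: f_def q_def w_def s_def)
  qed
  have "((\<lambda>n. f (i, n)) has_sum (c i * (E * (T ^ i / fact i)))) ?N" for i
    using has_sum_cmult_right[OF egf_coeff_prod_linear_powers[of "{1..r}" "\<lambda>j. - of_real (a j)" i t], of "c i"]
    by (simp add: f_def q_def w_def E_def T_def sum_negf)
  moreover have "((\<lambda>i. c i * (E * (T ^ i / fact i))) has_sum ((1 + T) powr x * E)) UNIV"
  proof -
    have "((\<lambda>i. (x gchoose i) * T ^ i) has_sum ((1 + T) powr x)) UNIV"
      using abs_binomial[OF norm_T] gen_binomial_complex[OF norm_T]
      by (rule norm_summable_imp_has_sum)
    from has_sum_cmult_left[OF this, of E] show ?thesis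
      by (simp add: c_def mult_ac)
  qed
  ultimately have "(f has_sum ((1 + T) powr x * E)) (UNIV \<times> ?N)"
    using summable_f by (intro has_sum_SigmaI)
  then have "((\<lambda>(n, i). f (i, n)) has_sum ((1 + T) powr x * E)) (?N \<times> UNIV)"
    by (subst (asm) has_sum_swap)
  moreover have "((\<lambda>i. case (n, i) of (n, i) \<Rightarrow> f (i, n)) has_sum (poly (umbral (q n)) x * w n)) UNIV" for n
  proof (rule has_sum_finite_neutralI)
    show "poly (umbral (q n)) x * w n = (\<Sum>i\<le>degree (q n). case (n, i) of (n, i) \<Rightarrow> f (i, n))"
      by (simp add: poly_umbral[OF order_refl] f_def c_def sum_distrib_left mult_ac)
  qed (auto simp: f_def coeff_eq_0)
  ultimately have "((\<lambda>n. poly (umbral (q n)) x * w n) has_sum ((1 + T) powr x * E)) ?N"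
    by (rule has_sum_SigmaD)
  moreover have "multiple_charlier r a n = umbral (q n)" for n
    unfolding q_def using assms(2,3) by (rule multiple_charlier_eq_umbral)
  ultimately show ?thesis
    by (simp add: q_def w_def T_def E_def prod_dividef)
qed

end
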